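(* Let $d \ge 2$ and $t\ge 2$ be fixed integers, and let $\mathcal{E} \subseteq \mathbb{F}_q^d$ have cardinality $|\mathcal{E}| \gg q^{(d+t-1)/2}$. For any non-degenerate bilinear form $B(\cdot,\cdot)$ on $\mathbb{F}_q^d$, consider the system of $\binom{t}{2}$ bilinear equations $$B(\boldsymbol{a}_i, \boldsymbol{a}_j) = \lambda_{ij}\quad (1 \le i<j\le t), \qquad \boldsymbol{a}_i \in \mathcal{E},\ i=1,\ldots,t.$$ Then this system is solvable for $(1-o(1)) q^{\binom{t}{2}}$ possible choices of $(\lambda_{ij})_{1\le i<j\le t}$ with $\lambda_{ij} \in \mathbb{F}_q$.
   Context: $q$ is a power of an odd prime, viewed as an asymptotic parameter: $q\to\infty$, the set $\mathcal{E}$ and the form $B$ may depend on $q$, and $o(1)$ denotes a quantity tending to $0$ as $q\to\infty$. $X \ll Y$ (equivalently $Y \gg X$) means $X = o(Y)$. *)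

theory Defs
  imports
    "HOL-Library.FuncSet"
    "HOL-Library.Landau_Symbols"
    "HOL-Number_Theory.Prime_Powers"
    "HOL-Algebra.Module"
begin

(* R^d. The fields mult and one belong to the module record but play no role for modules. *)
definition coord_space :: "('a, 'b) ring_scheme \<Rightarrow> nat \<Rightarrow> ('a, nat \<Rightarrow> 'a) module" where
  "coord_space R d =
    \<lparr>carrier = {1..d} \<rightarrow>\<^sub>E carrier R,
     mult = undefined,
     one = undefined,
     zero = (\<lambda>i\<in>{1..d}. \<zero>\<^bsub>R\<^esub>),
     add = (\<lambda>u v. \<lambda>i\<in>{1..d}. u i \<oplus>\<^bsub>R\<^esub> v i),
     smult = (\<lambda>c v. \<lambda>i\<in>{1..d}. c \<otimes>\<^bsub>R\<^esub> v i)\<rparr>"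

lemma coord_space_module:
  assumes "cring R"
  shows "Module.module R (coord_space R d)"
proof -
  interpret cring R by fact
  have inv: "\<exists>v\<in>{1..d} \<rightarrow>\<^sub>E carrier R. (\<lambda>i\<in>{1..d}. v i \<oplus>\<^bsub>R\<^esub> u i) = (\<lambda>i\<in>{1..d}. \<zero>\<^bsub>R\<^esub>)"
    if "u \<in> {1..d} \<rightarrow>\<^sub>E carrier R" for u
    using that
    by (intro bexI[of _ "\<lambda>i\<in>{1..d}. \<ominus>\<^bsub>R\<^esub> u i"])
       (auto simp: PiE_iff Pi_iff l_neg intro!: restrict_ext)
  show ?thesis
  proof (rule moduleI)
    show "abelian_group (coord_space R d)"
    proof (rule abelian_groupI)
      fix u assume "u \<in> carrier (coord_space R d)"
      then show "\<exists>v\<in>carrier (coord_space R d).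
          v \<oplus>\<^bsub>coord_space R d\<^esub> u = \<zero>\<^bsub>coord_space R d\<^esub>"
        using inv by (simp add: coord_space_def)
    qed (auto simp: coord_space_def PiE_iff Pi_iff extensional_def fun_eq_iff a_ac)
  qed (auto simp: coord_space_def PiE_iff Pi_iff extensional_def fun_eq_iff
        l_distr r_distr m_assoc assms)
qed

definition bilinear_form ::
  "('a, 'b) ring_scheme \<Rightarrow> ('a, 'v, 'c) module_scheme \<Rightarrow> ('v \<Rightarrow> 'v \<Rightarrow> 'a) \<Rightarrow> bool" where
  "bilinear_form R V B \<longleftrightarrow>
    (\<forall>u\<in>carrier V. \<forall>v\<in>carrier V. B u v \<in> carrier R) \<and>
    (\<forall>u\<in>carrier V. \<forall>v\<in>carrier V. \<forall>w\<in>carrier V.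
      B (u \<oplus>\<^bsub>V\<^esub> v) w = B u w \<oplus>\<^bsub>R\<^esub> B v w \<and>
      B w (u \<oplus>\<^bsub>V\<^esub> v) = B w u \<oplus>\<^bsub>R\<^esub> B w v) \<and>
    (\<forall>c\<in>carrier R. \<forall>u\<in>carrier V. \<forall>v\<in>carrier V.
      B (c \<odot>\<^bsub>V\<^esub> u) v = c \<otimes>\<^bsub>R\<^esub> B u v \<and>
      B u (c \<odot>\<^bsub>V\<^esub> v) = c \<otimes>\<^bsub>R\<^esub> B u v)"

(* Symmetry is not assumed, so both radicals are required to be trivial. *)
definition nondegenerate ::
  "('a, 'b) ring_scheme \<Rightarrow> ('a, 'v, 'c) module_scheme \<Rightarrow> ('v \<Rightarrow> 'v \<Rightarrow> 'a) \<Rightarrow> bool" where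
  "nondegenerate R V B \<longleftrightarrow>
    (\<forall>u\<in>carrier V. (\<forall>v\<in>carrier V. B u v = \<zero>\<^bsub>R\<^esub>) \<longrightarrow> u = \<zero>\<^bsub>V\<^esub>) \<and>
    (\<forall>v\<in>carrier V. (\<forall>u\<in>carrier V. B u v = \<zero>\<^bsub>R\<^esub>) \<longrightarrow> v = \<zero>\<^bsub>V\<^esub>)"

definition index_pairs :: "nat \<Rightarrow> (nat \<times> nat) set" where
  "index_pairs t = {(i, j). 1 \<le> i \<and> i < j \<and> j \<le> t}"

definition solvable_system :: "nat \<Rightarrow> 'v set \<Rightarrow> ('v \<Rightarrow> 'v \<Rightarrow> 'a) \<Rightarrow> (nat \<times> nat \<Rightarrow> 'a) \<Rightarrow> bool" where
  "solvable_system t E B l \<longleftrightarrow>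
    (\<exists>a. (\<forall>i\<in>{1..t}. a i \<in> E) \<and> (\<forall>(i, j)\<in>index_pairs t. B (a i) (a j) = l (i, j)))"

definition solvable_choices ::
  "('a, 'b) ring_scheme \<Rightarrow> nat \<Rightarrow> 'v set \<Rightarrow> ('v \<Rightarrow> 'v \<Rightarrow> 'a) \<Rightarrow> (nat \<times> nat \<Rightarrow> 'a) set" where
  "solvable_choices R t E B = {l \<in> index_pairs t \<rightarrow>\<^sub>E carrier R. solvable_system t E B l}"

end

theory Submission
  imports Defs "HOL-Analysis.Convex"
begin

text \<open>
  The proof is a second moment argument.  Send a tuple $(a_1, \ldots, a_t)$ of elements of \<open>E\<close> to
  the table of values $B(a_i, a_j)$ for $i < j$; the right-hand sides for which the system is
  solvable are the image of this map.  By Cauchy-Schwarz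
  (\<open>card_square_le_image_mult_collisions\<close>) the image has at least $|E|^{2t} / K$ elements, where
  $K$ is the number of pairs of tuples with the same table, so it suffices to show that
  $K \le (1 + o(1)) |E|^{2t} q^{-{t \choose 2}}$, which is what one would expect if the tables
  were equidistributed.

  A pair of tuples $(a_i)$, $(b_i)$ with the same table is a sequence of $t$ points
  $p_i = (a_i, b_i)$ of $E \times E$ with $D(p_i, p_j) = 0$ for $i < j$, where
  $D((x, x'), (y, y')) = B(x, y) - B(x', y')$.  This is again a nondegenerate bilinear form, now
  on a space of dimension $2d$, and $K$ counts cliques of size $t$ in its orthogonality relation
  (\<open>card_power_le_solvable_choices_mult_cliques\<close>).

  The orthogonality relation of a nondegenerate form on a space of $N$ elements is pseudorandom
  of density $1/q$ with error parameter $L = \sqrt{2N}$ (\<open>pseudorandom_orthogonality\<close>): two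
  vectors that do not lie on a common line have exactly $N / q^2$ common neighbours.  For the
  form $D$ this gives $L = \sqrt 2 q^d$.  In a pseudorandom relation, a set of $m$ vertices
  contains at most $(1 + o(1)) m^t q^{-{t \choose 2}}$ cliques of size $t$ as soon as $m$ is large
  compared with $L q^{t-1}$ (\<open>card_cliques_le\<close>).  For $m = |E|^2$ this is exactly the requirement
  that $|E|$ be large compared with $q^{(d+t-1)/2}$.
\<close>

section \<open>Counting cliques in pseudorandom relations\<close>

text \<open>
  The relation need not be symmetric and entries may repeat: only the pairs at positions
  $i < j$ are constrained, exactly as in the system of equations.  Lists with
  \<^const>\<open>sorted_wrt\<close> make the removal of the first vertex a structural step.
\<close>

definition cliques :: "('v \<Rightarrow> 'v \<Rightarrow> bool) \<Rightarrow> nat \<Rightarrow> 'v set \<Rightarrow> 'v list set" where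
  "cliques R t S = {xs. length xs = t \<and> set xs \<subseteq> S \<and> sorted_wrt R xs}"

text \<open>
  In spectral language, the relation behaves on \<open>V\<close> like a regular graph of density
  \<open>1 / q\<close> whose nontrivial singular values are at most \<open>L\<close>; this is the form in which
  that information enters all later estimates, and it can be verified by counting.
\<close>

definition pseudorandom :: "'v set \<Rightarrow> ('v \<Rightarrow> 'v \<Rightarrow> bool) \<Rightarrow> real \<Rightarrow> real \<Rightarrow> bool" where
  "pseudorandom V R q L \<longleftrightarrow>
    (\<forall>S\<subseteq>V. (\<Sum>x\<in>V. (real (card {y\<in>S. R x y}) - real (card S) / q)\<^sup>2) \<le> L\<^sup>2 * real (card S))"

lemma finite_cliques: "finite S \<Longrightarrow> finite (cliques R t S)"
  unfolding cliques_def
  by (rule finite_subset[OF _ finite_lists_length_eq[of S t]]) auto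

lemma card_cliques_one: "card (cliques R 1 S) = card S"
proof -
  have "cliques R 1 S = (\<lambda>x. [x]) ` S"
    by (auto simp: cliques_def length_Suc_conv)
  then show ?thesis by (simp add: card_image inj_on_def)
qed

lemma card_cliques_Suc:
  assumes "finite S"
  shows "card (cliques R (Suc t) S) = (\<Sum>x\<in>S. card (cliques R t {y\<in>S. R x y}))"
proof -
  have "cliques R (Suc t) S = (\<lambda>(x, xs). x # xs) ` (SIGMA x:S. cliques R t {y\<in>S. R x y})"
    by (auto simp: cliques_def length_Suc_conv image_iff subset_iff)
  then have "card (cliques R (Suc t) S) = card (SIGMA x:S. cliques R t {y\<in>S. R x y})"
    by (simp add: card_image inj_on_def split_beta prod_eq_iff)
  also have "\<dots> = (\<Sum>x\<in>S. card (cliques R t {y\<in>S. R x y}))"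
    using assms by (intro card_SigmaI) (auto intro: finite_cliques)
  finally show ?thesis .
qed

lemma pseudorandomD:
  assumes "pseudorandom V R q L" "finite V" "T \<subseteq> V" "S \<subseteq> V"
  shows "(\<Sum>x\<in>T. (real (card {y\<in>S. R x y}) - real (card S) / q)\<^sup>2) \<le> L\<^sup>2 * real (card S)"
proof -
  have "(\<Sum>x\<in>T. (real (card {y\<in>S. R x y}) - real (card S) / q)\<^sup>2)
      \<le> (\<Sum>x\<in>V. (real (card {y\<in>S. R x y}) - real (card S) / q)\<^sup>2)"
    using assms by (intro sum_mono2) auto
  also have "\<dots> \<le> L\<^sup>2 * real (card S)"
    using assms unfolding pseudorandom_def by blast
  finally show ?thesis .
qed

text \<open>
  The sizes of the neighbourhoods have mean square deviation at most \<open>L\<^sup>2\<close> over \<open>S\<close>, so by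
  Cauchy-Schwarz their sum deviates from its expected value by at most \<open>L\<close> per vertex.
\<close>

lemma card_cliques_two_le:
  assumes "pseudorandom V R q L" "finite V" "S \<subseteq> V" "L \<ge> 0"
  shows "real (card (cliques R 2 S)) \<le> (real (card S))\<^sup>2 / q + L * real (card S)"
proof -
  define e where "e x = real (card {y\<in>S. R x y}) - real (card S) / q" for x
  have fin: "finite S" using assms finite_subset by blast
  have "(\<Sum>x\<in>S. e x)\<^sup>2 \<le> (\<Sum>x\<in>S. (e x)\<^sup>2) * real (card S)"
    by (rule sum_squared_le_sum_of_squares)
  also have "\<dots> \<le> (L\<^sup>2 * real (card S)) * real (card S)"
    using pseudorandomD[OF assms(1-3) assms(3)] unfolding e_def by (intro mult_right_mono) auto
  also have "\<dots> = (L * real (card S))\<^sup>2" by (simp add: power2_eq_square)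
  finally have "(\<Sum>x\<in>S. e x) \<le> L * real (card S)"
    by (rule power2_le_imp_le) (use assms(4) in simp)
  moreover have "real (card (cliques R 2 S)) = (\<Sum>x\<in>S. real (card {y\<in>S. R x y}))"
    using card_cliques_Suc[OF fin, of R 1] card_cliques_one[of R] by (simp add: numeral_2_eq_2)
  moreover have "(\<Sum>x\<in>S. real (card {y\<in>S. R x y})) = (\<Sum>x\<in>S. e x) + (real (card S))\<^sup>2 / q"
    by (simp add: e_def sum_subtractf power2_eq_square)
  ultimately show ?thesis by linarith
qed

text \<open>
  Chebyshev's inequality.  The threshold is measured against an upper bound \<open>m\<close> for the size
  of \<open>S\<close> rather than against the size itself, which is what lets the induction below pass
  to neighbourhoods that are smaller than expected.
\<close>

lemma card_large_neighbourhoods_le: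
  assumes "pseudorandom V R q L" "finite V" "S \<subseteq> V" "q > 0" "\<delta> > 0"
    and "real (card S) \<le> m"
  shows "real (card {x\<in>S. real (card {y\<in>S. R x y}) > (1 + \<delta>) * m / q}) * (\<delta> * m / q)\<^sup>2
    \<le> L\<^sup>2 * m"
proof -
  let ?bad = "{x\<in>S. real (card {y\<in>S. R x y}) > (1 + \<delta>) * m / q}"
  have fin: "finite S" using assms finite_subset by blast
  have "(\<delta> * m / q)\<^sup>2 \<le> (real (card {y\<in>S. R x y}) - real (card S) / q)\<^sup>2" if "x \<in> ?bad" for x
  proof (intro power_mono)
    have "(1 + \<delta>) * m / q = m / q + \<delta> * m / q"
      by (simp add: algebra_simps add_divide_distrib)
    moreover have "real (card S) / q \<le> m / q" using assms by (intro divide_right_mono) auto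
    ultimately show "\<delta> * m / q \<le> real (card {y\<in>S. R x y}) - real (card S) / q"
      using that by auto
    show "0 \<le> \<delta> * m / q" using assms of_nat_0_le_iff[of "card S"] by (auto simp del: of_nat_0_le_iff)
  qed
  then have "real (card ?bad) * (\<delta> * m / q)\<^sup>2
      \<le> (\<Sum>x\<in>?bad. (real (card {y\<in>S. R x y}) - real (card S) / q)\<^sup>2)"
    by (intro sum_bounded_below) auto
  also have "\<dots> \<le> L\<^sup>2 * real (card S)"
    using assms by (intro pseudorandomD) auto
  also have "\<dots> \<le> L\<^sup>2 * m" using assms(6) by (intro mult_left_mono) auto
  finally show ?thesis .
qed

lemma choose_two_Suc: "Suc t choose 2 = (t choose 2) + t"
  by (simp add: numeral_2_eq_2)

text \<open>
  This is the upper half of Alon's counting lemma for pseudorandom graphs.  A clique of size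
  \<open>t + 1\<close> is a vertex \<open>x\<close> followed by a clique of size \<open>t\<close> in the neighbourhood of \<open>x\<close>.  For
  most \<open>x\<close> that neighbourhood has at most \<open>(1 + \<delta>) m / q\<close> elements, and since \<open>m / q\<close> is
  still large compared with \<open>L q ^ (t - 1)\<close>, the induction hypothesis gives the expected
  count.  By Chebyshev there are at most \<open>L\<^sup>2 q\<^sup>2 / (\<delta>\<^sup>2 m)\<close> other vertices, and for these it
  is enough to bound the number of cliques in the neighbourhood by the number in all of \<open>S\<close>:
  this loses a factor \<open>q ^ t\<close>, which is absorbed since \<open>m \<ge> C L q ^ t\<close> and \<open>t \<ge> 2\<close>.  That
  last estimate fails for the step from one vertex to two, so the induction starts at pairs.
\<close>

theorem card_cliques_le:
  fixes \<epsilon> :: real and t :: nat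
  assumes "t \<ge> 2" and "\<epsilon> > 0"
  shows "\<exists>C>0. \<forall>(V :: 'v set) R q L S m.
    finite V \<longrightarrow> pseudorandom V R q L \<longrightarrow> q \<ge> 1 \<longrightarrow> L > 0 \<longrightarrow> S \<subseteq> V \<longrightarrow>
    real (card S) \<le> m \<longrightarrow> C * L * q ^ (t - 1) \<le> m \<longrightarrow>
    real (card (cliques R t S)) \<le> (1 + \<epsilon>) * m ^ t / q ^ (t choose 2)"
  using assms
proof (induction t arbitrary: \<epsilon> rule: nat_induct_at_least)
  case base
  show ?case
  proof (intro exI[of _ "1 / \<epsilon>"] conjI allI impI)
    show "1 / \<epsilon> > 0" using base by simp
  next
    fix V :: "'v set" and R q L S m
    assume V: "finite V" "pseudorandom V R q L" and q: "q \<ge> 1" and L: "L > 0" and S: "S \<subseteq> V"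
      and Sm: "real (card S) \<le> m" and m: "1 / \<epsilon> * L * q ^ (2 - 1) \<le> m"
    have m0: "0 \<le> m" using Sm by linarith
    have "L \<le> \<epsilon> * m / q" using m q base by (simp add: field_simps)
    then have "L * real (card S) \<le> (\<epsilon> * m / q) * m"
      using L Sm m0 q base by (intro mult_mono) auto
    moreover have "(real (card S))\<^sup>2 / q \<le> m\<^sup>2 / q"
      using Sm q by (intro divide_right_mono power_mono) auto
    moreover have "m\<^sup>2 / q + (\<epsilon> * m / q) * m = (1 + \<epsilon>) * m\<^sup>2 / q"
      by (simp add: power2_eq_square algebra_simps add_divide_distrib)
    ultimately show "real (card (cliques R 2 S)) \<le> (1 + \<epsilon>) * m ^ 2 / q ^ (2 choose 2)"
      using card_cliques_two_le[OF V(2,1) S] L by simp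
  qed
next
  case (Suc t)
  have "((\<lambda>\<delta>::real. (1 + \<delta>) * (1 + \<delta>) ^ t) \<longlongrightarrow> (1 + 0) * (1 + 0) ^ t) (at_right 0)"
    by (intro tendsto_intros)
  then have "\<forall>\<^sub>F \<delta> in at_right 0. (1 + \<delta>) * (1 + \<delta>) ^ t < 1 + \<epsilon> / 2"
    using Suc.prems by (intro order_tendstoD(2)) auto
  then have "\<forall>\<^sub>F \<delta> in at_right 0. (1 + \<delta>) * (1 + \<delta>) ^ t < 1 + \<epsilon> / 2 \<and> \<delta> > 0"
    by (intro eventually_conj) (auto simp: eventually_at_right_less)
  then obtain \<delta> :: real where \<delta>: "(1 + \<delta>) * (1 + \<delta>) ^ t < 1 + \<epsilon> / 2" "\<delta> > 0"
    using eventually_happens[of _ "at_right (0::real)"] by auto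
  from Suc.IH[OF \<delta>(2)] obtain C where C: "C > 0" and
    "\<forall>(V :: 'v set) R q L S m.
      finite V \<longrightarrow> pseudorandom V R q L \<longrightarrow> q \<ge> 1 \<longrightarrow> L > 0 \<longrightarrow> S \<subseteq> V \<longrightarrow>
      real (card S) \<le> m \<longrightarrow> C * L * q ^ (t - 1) \<le> m \<longrightarrow>
      real (card (cliques R t S)) \<le> (1 + \<delta>) * m ^ t / q ^ (t choose 2)"
    by (elim exE conjE)
  note IH = this(2)[rule_format]
  \<comment> \<open>The first argument serves the induction hypothesis, the second makes the exceptional
    vertices contribute at most \<open>\<epsilon> / 2\<close> of the expected count.\<close>
  define A where "A = max C (sqrt (2 * (1 + \<delta>) / (\<delta>\<^sup>2 * \<epsilon>)))"
  have A: "A \<ge> C" "A > 0" using C by (auto simp: A_def)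
  have "2 * (1 + \<delta>) / (\<delta>\<^sup>2 * \<epsilon>) = (sqrt (2 * (1 + \<delta>) / (\<delta>\<^sup>2 * \<epsilon>)))\<^sup>2"
    using \<delta> Suc.prems by simp
  also have "\<dots> \<le> A\<^sup>2"
    using \<delta> Suc.prems by (intro power_mono) (auto simp: A_def)
  finally have A2: "1 + \<delta> \<le> \<epsilon> / 2 * \<delta>\<^sup>2 * A\<^sup>2"
    using \<delta> Suc.prems by (simp add: field_simps)
  show ?case
  proof (intro exI[of _ A] conjI allI impI A(2))
    fix V :: "'v set" and R q L S m
    assume V: "finite V" "pseudorandom V R q L" and q: "q \<ge> 1" and L: "L > 0" and S: "S \<subseteq> V"
      and Sm: "real (card S) \<le> m" and m: "A * L * q ^ (Suc t - 1) \<le> m"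
    have m_pos: "m > 0" using m A L q by (intro less_le_trans[OF _ m]) auto
    have fin: "finite S" using S V finite_subset by blast
    have t: "t = Suc (t - 1)" using Suc.hyps by linarith
    have "C * L * q ^ t \<le> A * L * q ^ t" using A L q by (intro mult_right_mono) auto
    then have m1: "C * L * q ^ t \<le> m" using m by simp
    have "C * L * q ^ (t - 1) \<le> C * L * q ^ t"
      using C L q by (intro mult_left_mono power_increasing) auto
    then have m2: "C * L * q ^ (t - 1) \<le> m" using m1 by simp
    have "q ^ t = q ^ (t - 1) * q" by (subst t) simp
    then have "C * L * q ^ (t - 1) * q \<le> m" using m1 by (simp add: mult_ac)
    then have "C * L * q ^ (t - 1) \<le> m / q" using q by (simp add: pos_le_divide_eq)
    also have "\<dots> \<le> (1 + \<delta>) * m / q" using \<delta> q m_pos by (intro divide_right_mono) auto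
    finally have m3: "C * L * q ^ (t - 1) \<le> (1 + \<delta>) * m / q" .
    let ?h = "\<lambda>x. {y\<in>S. R x y}"
    let ?K = "\<lambda>x. real (card (cliques R t (?h x)))"
    define bad where "bad = {x\<in>S. real (card (?h x)) > (1 + \<delta>) * m / q}"
    have bad: "bad \<subseteq> S" by (auto simp: bad_def)
    define Q where "Q = m ^ Suc t / q ^ (Suc t choose 2)"
    have Qeq: "Q = m * m ^ t / (q ^ (t choose 2) * q ^ t)"
      by (simp add: Q_def choose_two_Suc power_add)
    have Q_pos: "Q > 0" using m_pos q by (simp add: Q_def)
    have "(\<Sum>x\<in>S - bad. ?K x) \<le> real (card (S - bad)) * ((1 + \<delta>) * ((1 + \<delta>) * m / q) ^ t / q ^ (t choose 2))"
    proof (intro sum_bounded_above)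
      fix x assume "x \<in> S - bad"
      then show "?K x \<le> (1 + \<delta>) * ((1 + \<delta>) * m / q) ^ t / q ^ (t choose 2)"
        using S m3 by (intro IH[OF V q L]) (auto simp: bad_def)
    qed
    also have "\<dots> \<le> m * ((1 + \<delta>) * ((1 + \<delta>) * m / q) ^ t / q ^ (t choose 2))"
    proof (intro mult_right_mono)
      show "real (card (S - bad)) \<le> m"
        using Sm card_mono[OF fin, of "S - bad"] by auto
    qed (use \<delta> m_pos q in auto)
    also have "\<dots> = ((1 + \<delta>) * (1 + \<delta>) ^ t) * Q"
      by (simp add: Qeq power_mult_distrib power_divide mult_ac)
    also have "\<dots> \<le> (1 + \<epsilon> / 2) * Q"
      using \<delta> Q_pos by (intro mult_right_mono) auto
    finally have good_sum: "(\<Sum>x\<in>S - bad. ?K x) \<le> (1 + \<epsilon> / 2) * Q" .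
    have "(\<Sum>x\<in>bad. ?K x) \<le> real (card bad) * ((1 + \<delta>) * m ^ t / q ^ (t choose 2))"
    proof (intro sum_bounded_above)
      fix x assume "x \<in> bad"
      have "card (?h x) \<le> card S" by (intro card_mono fin) auto
      then show "?K x \<le> (1 + \<delta>) * m ^ t / q ^ (t choose 2)"
        using S Sm m2 by (intro IH[OF V q L]) auto
    qed
    also have "\<dots> \<le> (\<epsilon> / 2) * Q"
    proof -
      \<comment> \<open>The number of exceptional vertices is at most \<open>L\<^sup>2 q\<^sup>2 / (\<delta>\<^sup>2 m)\<close>; since \<open>q\<^sup>2 \<le> q ^ t\<close>,
        the lower bound on \<open>m\<close> makes this small compared with \<open>m / q ^ t\<close>.\<close>
      have b: "real (card bad) * (\<delta> * m / q)\<^sup>2 \<le> L\<^sup>2 * m"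
        unfolding bad_def using card_large_neighbourhoods_le[OF V(2,1) S _ \<delta>(2) Sm] q by simp
      have "real (card bad) * \<delta>\<^sup>2 * m * m = real (card bad) * (\<delta> * m / q)\<^sup>2 * q\<^sup>2"
        using q by (simp add: power2_eq_square)
      also have "\<dots> \<le> L\<^sup>2 * m * q\<^sup>2" using b by (intro mult_right_mono) auto
      finally have b1: "real (card bad) * \<delta>\<^sup>2 * m \<le> L\<^sup>2 * q\<^sup>2"
        using m_pos mult_le_cancel_right_pos[OF m_pos, of "real (card bad) * \<delta>\<^sup>2 * m" "L\<^sup>2 * q\<^sup>2"]
        by (simp add: mult_ac)
      have "L\<^sup>2 * q\<^sup>2 * q ^ t * A\<^sup>2 \<le> L\<^sup>2 * q ^ t * q ^ t * A\<^sup>2"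
        using q Suc.hyps
        by (intro mult_right_mono mult_left_mono power_increasing) auto
      also have "\<dots> = (A * L * q ^ t)\<^sup>2" by (simp add: power2_eq_square)
      also have "\<dots> \<le> m\<^sup>2" using m A L q by (intro power_mono) auto
      finally have b2: "L\<^sup>2 * q\<^sup>2 * q ^ t * A\<^sup>2 \<le> m\<^sup>2" .
      have "real (card bad) * (1 + \<delta>) * q ^ t * m \<le> real (card bad) * (\<epsilon> / 2 * \<delta>\<^sup>2 * A\<^sup>2) * q ^ t * m"
        using A2 m_pos q by (intro mult_right_mono mult_left_mono) auto
      also have "\<dots> = (real (card bad) * \<delta>\<^sup>2 * m) * (\<epsilon> / 2 * A\<^sup>2 * q ^ t)" by simp
      also have "\<dots> \<le> (L\<^sup>2 * q\<^sup>2) * (\<epsilon> / 2 * A\<^sup>2 * q ^ t)"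
        using Suc.prems q by (intro mult_right_mono b1) auto
      also have "\<dots> = \<epsilon> / 2 * (L\<^sup>2 * q\<^sup>2 * q ^ t * A\<^sup>2)" by simp
      also have "\<dots> \<le> \<epsilon> / 2 * m\<^sup>2" using Suc.prems by (intro mult_left_mono b2) auto
      finally have "real (card bad) * (1 + \<delta>) * q ^ t \<le> \<epsilon> / 2 * m"
        using m_pos by (simp add: power2_eq_square)
      then have "real (card bad) * (1 + \<delta>) \<le> \<epsilon> / 2 * m / q ^ t"
        using q by (simp add: pos_le_divide_eq)
      then have "real (card bad) * (1 + \<delta>) * (m ^ t / q ^ (t choose 2))
          \<le> \<epsilon> / 2 * m / q ^ t * (m ^ t / q ^ (t choose 2))"
        using m_pos q by (intro mult_right_mono) auto
      then show ?thesis by (simp add: Qeq mult_ac)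
    qed
    finally have "(\<Sum>x\<in>bad. ?K x) \<le> (\<epsilon> / 2) * Q" .
    moreover have "real (card (cliques R (Suc t) S)) = (\<Sum>x\<in>S - bad. ?K x) + (\<Sum>x\<in>bad. ?K x)"
      using sum.subset_diff[OF bad fin, of ?K] by (simp add: card_cliques_Suc[OF fin])
    ultimately have "real (card (cliques R (Suc t) S)) \<le> (1 + \<epsilon>) * Q"
      using good_sum by (simp add: algebra_simps)
    then show "real (card (cliques R (Suc t) S)) \<le> (1 + \<epsilon>) * m ^ Suc t / q ^ (Suc t choose 2)"
      by (simp add: Q_def)
  qed
qed

section \<open>Kernels of functionals on a finite module\<close>

definition functional :: "('a, 'b) ring_scheme \<Rightarrow> ('a, 'v, 'c) module_scheme \<Rightarrow> ('v \<Rightarrow> 'a) \<Rightarrow> bool" where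
  "functional R M \<phi> \<longleftrightarrow> (\<forall>x\<in>carrier M. \<phi> x \<in> carrier R) \<and>
    (\<forall>x\<in>carrier M. \<forall>y\<in>carrier M. \<phi> (x \<oplus>\<^bsub>M\<^esub> y) = \<phi> x \<oplus>\<^bsub>R\<^esub> \<phi> y) \<and>
    (\<forall>c\<in>carrier R. \<forall>x\<in>carrier M. \<phi> (c \<odot>\<^bsub>M\<^esub> x) = c \<otimes>\<^bsub>R\<^esub> \<phi> x)"

text \<open>
  A functional that takes the value one at \<open>u\<close> splits off the line through \<open>u\<close>.  Cardinalities
  of kernels follow without bases or dimensions.
\<close>

lemma (in module) bij_betw_kernel_times_scalars:
  assumes \<phi>: "functional R M \<phi>" and u: "u \<in> carrier M" "\<phi> u = \<one>"
  shows "bij_betw (\<lambda>(x, c). x \<oplus>\<^bsub>M\<^esub> c \<odot>\<^bsub>M\<^esub> u) ({x\<in>carrier M. \<phi> x = \<zero>} \<times> carrier R) (carrier M)"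
proof (rule bij_betw_byWitness[where f' = "\<lambda>x. (x \<oplus>\<^bsub>M\<^esub> (\<ominus> \<phi> x) \<odot>\<^bsub>M\<^esub> u, \<phi> x)"])
  note lin = \<phi>[unfolded functional_def]
  show "\<forall>a\<in>{x \<in> carrier M. \<phi> x = \<zero>} \<times> carrier R.
      (\<lambda>x. (x \<oplus>\<^bsub>M\<^esub> (\<ominus> \<phi> x) \<odot>\<^bsub>M\<^esub> u, \<phi> x)) ((\<lambda>(x, c). x \<oplus>\<^bsub>M\<^esub> c \<odot>\<^bsub>M\<^esub> u) a) = a"
    using u by (auto simp: lin M.a_assoc smult_l_distr[symmetric] R.r_neg)
  show "\<forall>x\<in>carrier M.
      (\<lambda>(x, c). x \<oplus>\<^bsub>M\<^esub> c \<odot>\<^bsub>M\<^esub> u) (x \<oplus>\<^bsub>M\<^esub> (\<ominus> \<phi> x) \<odot>\<^bsub>M\<^esub> u, \<phi> x) = x"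
    using u by (auto simp: lin M.a_assoc smult_l_distr[symmetric] R.l_neg)
qed (use u in \<open>auto simp: \<phi>[unfolded functional_def] R.r_neg\<close>)

lemma functional_normalise:
  fixes R (structure) and M (structure)
  assumes "Ring.field R" "Module.module R M" "functional R M \<phi>" "u \<in> carrier M" "\<phi> u \<noteq> \<zero>\<^bsub>R\<^esub>"
  obtains v where "v \<in> carrier M" "\<phi> v = \<one>\<^bsub>R\<^esub>"
proof -
  interpret field R by fact
  interpret module R M by fact
  have "inv (\<phi> u) \<in> carrier R" "inv (\<phi> u) \<otimes> \<phi> u = \<one>"
    using assms by (auto simp: functional_def field_Units)
  then have "inv (\<phi> u) \<odot>\<^bsub>M\<^esub> u \<in> carrier M" "\<phi> (inv (\<phi> u) \<odot>\<^bsub>M\<^esub> u) = \<one>"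
    using assms by (auto simp: functional_def)
  then show ?thesis using that by blast
qed

lemma card_kernel_functional:
  fixes R (structure) and M (structure)
  assumes "Ring.field R" "Module.module R M" "functional R M \<phi>" "u \<in> carrier M" "\<phi> u \<noteq> \<zero>\<^bsub>R\<^esub>"
  shows "card {x\<in>carrier M. \<phi> x = \<zero>\<^bsub>R\<^esub>} * card (carrier R) = card (carrier M)"
proof -
  interpret module R M by fact
  obtain v where "v \<in> carrier M" "\<phi> v = \<one>\<^bsub>R\<^esub>"
    using functional_normalise[OF assms] by blast
  then show ?thesis
    using bij_betw_same_card[OF bij_betw_kernel_times_scalars[OF assms(3)]]
    by (simp add: card_cartesian_product)
qed

lemma functional_zero:
  fixes R (structure) and M (structure)
  assumes "Module.module R M" "functional R M \<phi>"
  shows "\<phi> \<zero>\<^bsub>M\<^esub> = \<zero>\<^bsub>R\<^esub>"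
proof -
  interpret module R M by fact
  have "\<phi> (\<zero> \<odot>\<^bsub>M\<^esub> \<zero>\<^bsub>M\<^esub>) = \<zero> \<otimes> \<phi> \<zero>\<^bsub>M\<^esub>"
    using assms(2) by (auto simp: functional_def simp del: smult_r_null smult_l_null)
  then show ?thesis using assms(2) by (auto simp: functional_def)
qed

lemma submodule_kernel:
  fixes R (structure) and M (structure)
  assumes "Module.module R M" "functional R M \<phi>"
  shows "submodule {x\<in>carrier M. \<phi> x = \<zero>\<^bsub>R\<^esub>} R M"
proof -
  interpret module R M by fact
  show ?thesis
  proof (rule submoduleI)
    fix a assume a: "a \<in> {x \<in> carrier M. \<phi> x = \<zero>}"
    then have "\<ominus>\<^bsub>M\<^esub> a = (\<ominus> \<one>) \<odot>\<^bsub>M\<^esub> a" by (simp add: smult_l_minus)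
    then show "\<ominus>\<^bsub>M\<^esub> a \<in> {x \<in> carrier M. \<phi> x = \<zero>}"
      using a assms(2) by (auto simp: functional_def)
  qed (use assms functional_zero[OF assms] in \<open>auto simp: functional_def\<close>)
qed

text \<open>
  The hypothesis on \<open>v\<close> says that the second functional does not vanish on the kernel of the
  first, so the count for a single functional can be applied inside that kernel.
\<close>

lemma card_kernel_functional_pair:
  fixes R (structure) and M (structure)
  assumes "Ring.field R" "Module.module R M" "functional R M \<phi>" "functional R M \<psi>"
    and "u \<in> carrier M" "\<phi> u \<noteq> \<zero>\<^bsub>R\<^esub>" and "v \<in> carrier M" "\<phi> v = \<zero>\<^bsub>R\<^esub>" "\<psi> v \<noteq> \<zero>\<^bsub>R\<^esub>"
  shows "card {x\<in>carrier M. \<phi> x = \<zero>\<^bsub>R\<^esub> \<and> \<psi> x = \<zero>\<^bsub>R\<^esub>} * (card (carrier R))\<^sup>2 = card (carrier M)"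
proof -
  interpret module R M by fact
  let ?K = "{x\<in>carrier M. \<phi> x = \<zero>\<^bsub>R\<^esub>}"
  let ?N = "M\<lparr>carrier := ?K\<rparr>"
  have "Module.module R ?N"
    using submodule_kernel[OF assms(2,3)] by (rule submodule.submodule_is_module) fact
  moreover have "functional R ?N \<psi>" using assms(4) by (auto simp: functional_def)
  ultimately have "card {x\<in>carrier ?N. \<psi> x = \<zero>\<^bsub>R\<^esub>} * card (carrier R) = card (carrier ?N)"
    using assms by (intro card_kernel_functional[where u = v]) auto
  moreover have "card ?K * card (carrier R) = card (carrier M)"
    using assms by (intro card_kernel_functional)
  moreover have "{x\<in>carrier ?N. \<psi> x = \<zero>\<^bsub>R\<^esub>} = {x\<in>carrier M. \<phi> x = \<zero>\<^bsub>R\<^esub> \<and> \<psi> x = \<zero>\<^bsub>R\<^esub>}" by auto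
  ultimately show ?thesis by (simp add: power2_eq_square mult.assoc[symmetric])
qed

text \<open>
  The alternative to the previous lemma: if the second functional vanishes on the kernel of the
  first, it is determined by its value at a point \<open>v\<close> where the first one is one, because
  $x - \phi(x) v$ lies in that kernel.
\<close>

lemma functional_proportional:
  fixes R (structure) and M (structure)
  assumes "Ring.field R" "Module.module R M" "functional R M \<phi>" "functional R M \<psi>"
    and ker: "\<And>x. x \<in> carrier M \<Longrightarrow> \<phi> x = \<zero>\<^bsub>R\<^esub> \<Longrightarrow> \<psi> x = \<zero>\<^bsub>R\<^esub>"
    and "u \<in> carrier M" "\<phi> u \<noteq> \<zero>\<^bsub>R\<^esub>"
  shows "\<exists>c\<in>carrier R. \<forall>x\<in>carrier M. \<psi> x = c \<otimes>\<^bsub>R\<^esub> \<phi> x"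
proof -
  interpret module R M by fact
  obtain v where v: "v \<in> carrier M" "\<phi> v = \<one>"
    using functional_normalise[OF assms(1-3,6,7)] by blast
  have "\<psi> x = \<psi> v \<otimes> \<phi> x" if x: "x \<in> carrier M" for x
  proof -
    have c: "\<phi> x \<in> carrier R" "\<psi> x \<in> carrier R" "\<psi> v \<in> carrier R"
      using assms(3,4) x v by (auto simp: functional_def)
    let ?y = "x \<oplus>\<^bsub>M\<^esub> (\<ominus> \<phi> x) \<odot>\<^bsub>M\<^esub> v"
    have y: "?y \<in> carrier M" using x v c by simp
    have eval: "\<chi> ?y = \<chi> x \<oplus> (\<ominus> \<phi> x) \<otimes> \<chi> v" if "functional R M \<chi>" for \<chi>
      using that x v(1) c(1) by (simp add: functional_def)
    have "\<phi> ?y = \<zero>" using eval[OF assms(3)] v(2) c by (simp add: R.r_neg)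
    then have "\<psi> x \<oplus> \<ominus> (\<phi> x \<otimes> \<psi> v) = \<zero>"
      using ker[OF y] eval[OF assms(4)] c by (simp add: R.l_minus)
    then have "\<psi> x = \<phi> x \<otimes> \<psi> v"
      using c R.minus_equality[of "\<psi> x" "\<ominus> (\<phi> x \<otimes> \<psi> v)"] by simp
    then show ?thesis using c by (simp add: R.m_comm)
  qed
  moreover have "\<psi> v \<in> carrier R" using assms(4) v(1) by (simp add: functional_def)
  ultimately show ?thesis by blast
qed

section \<open>Pseudorandomness of orthogonality\<close>

lemma sum_card_square:
  assumes "finite V" "finite S"
  shows "(\<Sum>x\<in>V. (card {y\<in>S. R x y})\<^sup>2) = (\<Sum>y\<in>S. \<Sum>y'\<in>S. card {x\<in>V. R x y \<and> R x y'})"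
proof -
  have ind: "card {z\<in>A. P z} = (\<Sum>z\<in>A. of_bool (P z))" if "finite A" for A :: "'c set" and P
    using that by (simp add: Int_def)
  have "(card {y\<in>S. R x y})\<^sup>2 = (\<Sum>y\<in>S. \<Sum>y'\<in>S. of_bool (R x y \<and> R x y'))" for x
    by (simp only: ind[OF assms(2)] power2_eq_square sum_product of_bool_conj)
  then have "(\<Sum>x\<in>V. (card {y\<in>S. R x y})\<^sup>2) = (\<Sum>x\<in>V. \<Sum>y\<in>S. \<Sum>y'\<in>S. of_bool (R x y \<and> R x y'))"
    by simp
  also have "\<dots> = (\<Sum>y\<in>S. \<Sum>x\<in>V. \<Sum>y'\<in>S. of_bool (R x y \<and> R x y'))"
    by (rule sum.swap)
  also have "\<dots> = (\<Sum>y\<in>S. \<Sum>y'\<in>S. \<Sum>x\<in>V. of_bool (R x y \<and> R x y'))"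
    by (intro sum.cong refl sum.swap)
  finally show ?thesis by (simp only: ind[OF assms(1)])
qed

lemma sum_card_neighbours:
  assumes "finite V" "finite S"
  shows "(\<Sum>x\<in>V. card {y\<in>S. R x y}) = (\<Sum>y\<in>S. card {x\<in>V. R x y})"
  using sum_multicount_gen[OF assms, of R "\<lambda>y. card {x\<in>V. R x y}"] by simp

text \<open>
  Expanding the square turns the sum of squared neighbourhood sizes into a sum of codegrees and
  the cross term into a sum of degrees.  The main terms, in which each degree is \<open>card V / q\<close>
  and each codegree \<open>card V / q\<^sup>2\<close>, cancel.
\<close>

lemma pseudorandomI_codegrees:
  fixes q :: real
  assumes V: "finite V" and q: "q > 0"
    and deg: "\<And>y. y \<in> V \<Longrightarrow> real (card V) / q \<le> real (card {x\<in>V. R x y})"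
    and codeg: "\<And>S. S \<subseteq> V \<Longrightarrow> (\<Sum>y\<in>S. \<Sum>y'\<in>S. real (card {x\<in>V. R x y \<and> R x y'}))
      \<le> (real (card S))\<^sup>2 * real (card V) / q\<^sup>2 + L\<^sup>2 * real (card S)"
  shows "pseudorandom V R q L"
  unfolding pseudorandom_def
proof (intro allI impI)
  fix S assume S: "S \<subseteq> V"
  then have fin: "finite S" using V finite_subset by blast
  let ?h = "\<lambda>x. real (card {y\<in>S. R x y})"
  let ?s = "real (card S)" and ?n = "real (card V)"
  have "(\<Sum>x\<in>V. (?h x - ?s / q)\<^sup>2)
      = (\<Sum>x\<in>V. (?h x)\<^sup>2) - 2 * (?s / q) * (\<Sum>x\<in>V. ?h x) + ?n * (?s / q)\<^sup>2"
    by (simp add: power2_diff sum.distrib sum_subtractf sum_distrib_left mult_ac)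
  moreover have "(\<Sum>x\<in>V. (?h x)\<^sup>2) \<le> ?s\<^sup>2 * ?n / q\<^sup>2 + L\<^sup>2 * ?s"
  proof -
    have "(\<Sum>x\<in>V. (?h x)\<^sup>2) = real (\<Sum>x\<in>V. (card {y\<in>S. R x y})\<^sup>2)" by simp
    also have "\<dots> = (\<Sum>y\<in>S. \<Sum>y'\<in>S. real (card {x\<in>V. R x y \<and> R x y'}))"
      unfolding sum_card_square[OF V fin] by simp
    finally show ?thesis using codeg[OF S] by simp
  qed
  moreover have "2 * (?s / q) * (?s * (?n / q)) \<le> 2 * (?s / q) * (\<Sum>x\<in>V. ?h x)"
  proof (intro mult_left_mono)
    have "?s * (?n / q) \<le> (\<Sum>y\<in>S. real (card {x\<in>V. R x y}))"
      using deg S by (intro sum_bounded_below) auto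
    also have "\<dots> = real (\<Sum>x\<in>V. card {y\<in>S. R x y})"
      unfolding sum_card_neighbours[OF V fin] by simp
    finally show "?s * (?n / q) \<le> (\<Sum>x\<in>V. ?h x)" by simp
  qed (use q in auto)
  moreover have "2 * (?s / q) * (?s * (?n / q)) = ?s\<^sup>2 * ?n / q\<^sup>2 + ?n * (?s / q)\<^sup>2"
    by (simp add: power2_eq_square)
  ultimately show "(\<Sum>x\<in>V. (?h x - ?s / q)\<^sup>2) \<le> L\<^sup>2 * ?s" by linarith
qed

lemma functional_bilinear_left:
  "bilinear_form R M B \<Longrightarrow> y \<in> carrier M \<Longrightarrow> functional R M (\<lambda>x. B x y)"
  "bilinear_form R M B \<Longrightarrow> y \<in> carrier M \<Longrightarrow> functional R M (\<lambda>x. B y x)"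
  by (auto simp: bilinear_form_def functional_def)

text \<open>
  Nondegeneracy in the form in which it is used: a vector is determined by the functional that
  it represents.
\<close>

lemma nondegenerate_eqI:
  fixes R (structure) and M (structure)
  assumes "Module.module R M" "bilinear_form R M B" "nondegenerate R M B"
    and yz: "y \<in> carrier M" "z \<in> carrier M" and eq: "\<And>x. x \<in> carrier M \<Longrightarrow> B x y = B x z"
  shows "y = z"
proof -
  interpret module R M by fact
  have "B x (y \<oplus>\<^bsub>M\<^esub> (\<ominus> \<one>) \<odot>\<^bsub>M\<^esub> z) = \<zero>" if "x \<in> carrier M" for x
  proof -
    have "B x z \<in> carrier R" using that yz assms(2) by (auto simp: bilinear_form_def)
    then show ?thesis
      using functional_bilinear_left(2)[OF assms(2) that] that yz eq[OF that]
      by (simp add: functional_def R.l_minus R.r_neg)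
  qed
  then have "y \<oplus>\<^bsub>M\<^esub> (\<ominus> \<one>) \<odot>\<^bsub>M\<^esub> z = \<zero>\<^bsub>M\<^esub>"
    using assms(3) yz by (auto simp: nondegenerate_def)
  then show ?thesis
    using M.minus_equality[of y "\<ominus>\<^bsub>M\<^esub> z"] yz by (simp add: smult_l_minus)
qed

text \<open>
  For \<open>y \<noteq> 0\<close> the codegree of \<open>y\<close> and \<open>y'\<close> is exactly \<open>N / q\<^sup>2\<close> unless the functionals that
  they represent are proportional, and by nondegeneracy this happens only for the at most \<open>q\<close>
  vectors \<open>y'\<close> on the line through \<open>y\<close>.  Each of these costs at most \<open>N / q\<close>, so a nonzero \<open>y\<close>
  contributes an excess of at most \<open>N\<close>.  The zero vector is orthogonal to everything and costs
  up to \<open>N\<close> for each \<open>y'\<close>, but it is only one vector.  Summed over \<open>S\<close>, the excess is at most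
  \<open>2 N card S\<close>.
\<close>

theorem pseudorandom_orthogonality:
  fixes R (structure) and M (structure)
  assumes F: "Ring.field R" and M: "Module.module R M"
    and fin: "finite (carrier R)" "finite (carrier M)"
    and B: "bilinear_form R M B" "nondegenerate R M B"
  shows "pseudorandom (carrier M) (\<lambda>x y. B x y = \<zero>\<^bsub>R\<^esub>)
    (real (card (carrier R))) (sqrt (2 * real (card (carrier M))))"
proof -
  interpret module R M by fact
  let ?V = "carrier M"
  define q where "q = real (card (carrier R))"
  define N where "N = real (card ?V)"
  define c where "c y y' = real (card {x\<in>?V. B x y = \<zero>\<^bsub>R\<^esub> \<and> B x y' = \<zero>\<^bsub>R\<^esub>})" for y y'
  have "card (carrier R) > 0" using fin(1) R.zero_closed by (auto simp: card_gt_0_iff)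
  then have q: "q \<ge> 1" by (simp add: q_def)
  have func: "functional R M (\<lambda>x. B x y)" if "y \<in> ?V" for y
    using functional_bilinear_left(1)[OF B(1) that] .
  have witness: "\<exists>u\<in>?V. B u y \<noteq> \<zero>\<^bsub>R\<^esub>" if "y \<in> ?V" "y \<noteq> \<zero>\<^bsub>M\<^esub>" for y
    using B(2) that by (auto simp: nondegenerate_def)
  have deg: "real (card {x\<in>?V. B x y = \<zero>\<^bsub>R\<^esub>}) = N / q" if y: "y \<in> ?V" "y \<noteq> \<zero>\<^bsub>M\<^esub>" for y
  proof -
    obtain u where "u \<in> ?V" "B u y \<noteq> \<zero>\<^bsub>R\<^esub>" using witness[OF y] by blast
    from card_kernel_functional[OF F M func[OF y(1)] this]
    have "real (card {x\<in>?V. B x y = \<zero>\<^bsub>R\<^esub>}) * q = N"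
      unfolding q_def N_def by (simp only: of_nat_mult[symmetric])
    then show ?thesis using q by (simp add: field_simps)
  qed
  have codeg_le: "c y y' \<le> real (card {x\<in>?V. B x y = \<zero>\<^bsub>R\<^esub>})"
      "c y y' \<le> real (card {x\<in>?V. B x y' = \<zero>\<^bsub>R\<^esub>})" "c y y' \<le> N" for y y'
    unfolding c_def N_def of_nat_le_iff using fin(2) by (auto intro!: card_mono)
  have codeg: "c y y' = N / q\<^sup>2"
    if y: "y \<in> ?V" "y \<noteq> \<zero>\<^bsub>M\<^esub>" and y': "y' \<in> ?V" "y' \<notin> (\<lambda>a. a \<odot>\<^bsub>M\<^esub> y) ` carrier R" for y y'
  proof -
    obtain u where u: "u \<in> ?V" "B u y \<noteq> \<zero>\<^bsub>R\<^esub>" using witness[OF y] by blast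
    have "\<exists>v\<in>?V. B v y = \<zero>\<^bsub>R\<^esub> \<and> B v y' \<noteq> \<zero>\<^bsub>R\<^esub>"
    proof (rule ccontr)
      assume "\<not> ?thesis"
      then have "\<And>x. x \<in> ?V \<Longrightarrow> B x y = \<zero>\<^bsub>R\<^esub> \<Longrightarrow> B x y' = \<zero>\<^bsub>R\<^esub>" by blast
      from functional_proportional[OF F M func[OF y(1)] func[OF y'(1)] this u]
      obtain a where a: "a \<in> carrier R" "\<forall>x\<in>?V. B x y' = a \<otimes>\<^bsub>R\<^esub> B x y" by blast
      have "y' = a \<odot>\<^bsub>M\<^esub> y"
      proof (rule nondegenerate_eqI[OF M B])
        show "B x y' = B x (a \<odot>\<^bsub>M\<^esub> y)" if "x \<in> ?V" for x
          using a that y(1) B(1) unfolding bilinear_form_def by metis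
      qed (use a y y' in auto)
      then show False using a y' by blast
    qed
    then obtain v where "v \<in> ?V" "B v y = \<zero>\<^bsub>R\<^esub>" "B v y' \<noteq> \<zero>\<^bsub>R\<^esub>" by blast
    from card_kernel_functional_pair[OF F M func[OF y(1)] func[OF y'(1)] u this]
    have "c y y' * q\<^sup>2 = N" unfolding q_def N_def c_def
      by (simp only: of_nat_mult[symmetric] of_nat_power[symmetric])
    then show ?thesis using q by (simp add: field_simps)
  qed
  have N: "N \<ge> 0" by (simp add: N_def)
  have Nq: "N / q \<le> N" "0 \<le> N / q\<^sup>2" using q N mult_left_mono[OF q N] by (simp_all add: pos_divide_le_eq)
  show ?thesis
    unfolding q_def[symmetric] N_def[symmetric]
  proof (rule pseudorandomI_codegrees[OF fin(2)])
    show "q > 0" using q by simp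
  next
    fix y assume y: "y \<in> ?V"
    show "real (card ?V) / q \<le> real (card {x \<in> ?V. B x y = \<zero>\<^bsub>R\<^esub>})"
    proof (cases "y = \<zero>\<^bsub>M\<^esub>")
      case True
      then have "{x \<in> ?V. B x y = \<zero>\<^bsub>R\<^esub>} = ?V"
        using functional_zero[OF M functional_bilinear_left(2)[OF B(1)]] by auto
      then show ?thesis using Nq by (simp add: N_def)
    next
      case False
      then show ?thesis using deg[OF y] by (simp add: N_def)
    qed
  next
    fix S assume S: "S \<subseteq> ?V"
    then have finS: "finite S" using fin(2) finite_subset by blast
    let ?s = "real (card S)"
    have row: "(\<Sum>y'\<in>S. c y y') \<le> ?s * (N / q\<^sup>2) + N + (if y = \<zero>\<^bsub>M\<^esub> then ?s * N else 0)"
      if y: "y \<in> S" for y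
    proof (cases "y = \<zero>\<^bsub>M\<^esub>")
      case True
      have "(\<Sum>y'\<in>S. c y y') \<le> ?s * N" using codeg_le(3) by (intro sum_bounded_above)
      moreover have "0 \<le> ?s * (N / q\<^sup>2)" using Nq by (intro mult_nonneg_nonneg) auto
      ultimately have "(\<Sum>y'\<in>S. c y y') \<le> ?s * (N / q\<^sup>2) + N + ?s * N" using N by linarith
      then show ?thesis using True by simp
    next
      case False
      let ?L = "(\<lambda>a. a \<odot>\<^bsub>M\<^esub> y) ` carrier R"
      have "c y y' \<le> N / q\<^sup>2 + (if y' \<in> ?L then N / q else 0)" if "y' \<in> S" for y'
      proof (cases "y' \<in> ?L")
        case True
        have "c y y' \<le> N / q" using codeg_le(1)[of y y'] deg[of y] y S False by auto
        then have "c y y' \<le> N / q\<^sup>2 + N / q" by (rule add_increasing[OF Nq(2)])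
        then show ?thesis using True by simp
      next
        case outside: False
        have "y \<in> ?V" "y' \<in> ?V" using y that S by auto
        then show ?thesis using codeg[OF _ False _ outside] outside by simp
      qed
      then have "(\<Sum>y'\<in>S. c y y') \<le> (\<Sum>y'\<in>S. N / q\<^sup>2 + (if y' \<in> ?L then N / q else 0))"
        by (rule sum_mono)
      also have "\<dots> = ?s * (N / q\<^sup>2) + real (card (S \<inter> ?L)) * (N / q)"
        using finS by (simp add: sum.distrib sum.If_cases)
      also have "\<dots> \<le> ?s * (N / q\<^sup>2) + q * (N / q)"
      proof -
        have "card (S \<inter> ?L) \<le> card ?L" using fin(1) by (intro card_mono) auto
        also have "\<dots> \<le> card (carrier R)" using fin(1) by (rule card_image_le)
        finally have "real (card (S \<inter> ?L)) \<le> q" by (simp add: q_def)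
        then show ?thesis using N q by (intro add_left_mono mult_right_mono) auto
      qed
      finally show ?thesis using False q by simp
    qed
    have "(\<Sum>y\<in>S. \<Sum>y'\<in>S. c y y')
        \<le> (\<Sum>y\<in>S. ?s * (N / q\<^sup>2) + N + (if y = \<zero>\<^bsub>M\<^esub> then ?s * N else 0))"
      by (intro sum_mono row)
    also have "\<dots> \<le> ?s * (?s * (N / q\<^sup>2) + N) + ?s * N"
      using finS N by (simp add: sum.distrib sum.delta algebra_simps)
    also have "\<dots> = ?s\<^sup>2 * N / q\<^sup>2 + 2 * N * ?s"
      by (simp add: power2_eq_square algebra_simps)
    finally show "(\<Sum>y\<in>S. \<Sum>y'\<in>S. real (card {x \<in> ?V. B x y = \<zero>\<^bsub>R\<^esub> \<and> B x y' = \<zero>\<^bsub>R\<^esub>}))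
        \<le> ?s\<^sup>2 * real (card ?V) / q\<^sup>2 + (sqrt (2 * N))\<^sup>2 * ?s"
      using N by (simp add: c_def N_def)
  qed
qed

section \<open>The direct sum of a module with itself\<close>

text \<open>
  The direct sum of a module with itself.  The two ring components are filled with arbitrary
  values since the record type of modules extends that of rings.
\<close>

definition double_module :: "('a, 'v, 'c) module_scheme \<Rightarrow> ('a, 'v \<times> 'v) module" where
  "double_module M =
    \<lparr>carrier = carrier M \<times> carrier M,
     mult = undefined,
     one = undefined,
     zero = (\<zero>\<^bsub>M\<^esub>, \<zero>\<^bsub>M\<^esub>),
     add = (\<lambda>(x, x') (y, y'). (x \<oplus>\<^bsub>M\<^esub> y, x' \<oplus>\<^bsub>M\<^esub> y')),
     smult = (\<lambda>c (x, x'). (c \<odot>\<^bsub>M\<^esub> x, c \<odot>\<^bsub>M\<^esub> x'))\<rparr>"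

text \<open>
  Two pairs are orthogonal for this form if and only if \<open>B x y = B x' y'\<close>, so orthogonality
  expresses a coincidence of values of \<open>B\<close>.
\<close>

definition difference_form ::
  "('a, 'b) ring_scheme \<Rightarrow> ('v \<Rightarrow> 'v \<Rightarrow> 'a) \<Rightarrow> 'v \<times> 'v \<Rightarrow> 'v \<times> 'v \<Rightarrow> 'a" where
  "difference_form R B = (\<lambda>(x, x') (y, y'). B x y \<ominus>\<^bsub>R\<^esub> B x' y')"

lemma double_module_simps [simp]:
  "carrier (double_module M) = carrier M \<times> carrier M"
  "\<zero>\<^bsub>double_module M\<^esub> = (\<zero>\<^bsub>M\<^esub>, \<zero>\<^bsub>M\<^esub>)"
  "(x, x') \<oplus>\<^bsub>double_module M\<^esub> (y, y') = (x \<oplus>\<^bsub>M\<^esub> y, x' \<oplus>\<^bsub>M\<^esub> y')"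
  "c \<odot>\<^bsub>double_module M\<^esub> (x, x') = (c \<odot>\<^bsub>M\<^esub> x, c \<odot>\<^bsub>M\<^esub> x')"
  by (simp_all add: double_module_def)

lemma module_double_module:
  fixes R (structure) and M (structure)
  assumes "Module.module R M"
  shows "Module.module R (double_module M)"
proof -
  interpret module R M by fact
  show ?thesis
  proof (rule moduleI)
    show "cring R" by (rule R.is_cring)
    show "abelian_group (double_module M)"
    proof (rule abelian_groupI)
      fix x assume "x \<in> carrier (double_module M)"
      then obtain a b where x: "x = (a, b)" "a \<in> carrier M" "b \<in> carrier M" by auto
      then show "\<exists>y\<in>carrier (double_module M). y \<oplus>\<^bsub>double_module M\<^esub> x = \<zero>\<^bsub>double_module M\<^esub>"
        by (intro bexI[of _ "(\<ominus>\<^bsub>M\<^esub> a, \<ominus>\<^bsub>M\<^esub> b)"]) (auto simp: M.l_neg)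
    qed (auto simp: M.a_ac)
  qed (auto simp: smult_l_distr smult_r_distr smult_assoc1)
qed

lemma bilinear_form_zero:
  fixes R (structure) and M (structure)
  assumes "Module.module R M" "bilinear_form R M B" "x \<in> carrier M"
  shows "B x \<zero>\<^bsub>M\<^esub> = \<zero>\<^bsub>R\<^esub>" "B \<zero>\<^bsub>M\<^esub> x = \<zero>\<^bsub>R\<^esub>"
  using functional_zero[OF assms(1) functional_bilinear_left(1)[OF assms(2,3)]]
    functional_zero[OF assms(1) functional_bilinear_left(2)[OF assms(2,3)]] by auto

lemma bilinear_form_difference_form:
  fixes R (structure) and M (structure)
  assumes "Module.module R M" "bilinear_form R M B"
  shows "bilinear_form R (double_module M) (difference_form R B)"
proof -
  interpret module R M by fact
  have closed: "B x y \<in> carrier R" if "x \<in> carrier M" "y \<in> carrier M" for x y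
    using assms(2) that by (auto simp: bilinear_form_def)
  have lin: "B (x \<oplus>\<^bsub>M\<^esub> y) z = B x z \<oplus> B y z" "B z (x \<oplus>\<^bsub>M\<^esub> y) = B z x \<oplus> B z y"
    if "x \<in> carrier M" "y \<in> carrier M" "z \<in> carrier M" for x y z
    using assms(2) that by (auto simp: bilinear_form_def)
  have smult: "B (c \<odot>\<^bsub>M\<^esub> x) y = c \<otimes> B x y" "B x (c \<odot>\<^bsub>M\<^esub> y) = c \<otimes> B x y"
    if "c \<in> carrier R" "x \<in> carrier M" "y \<in> carrier M" for c x y
    using assms(2) that by (auto simp: bilinear_form_def)
  have add_minus: "(a \<oplus> b) \<ominus> (c \<oplus> d) = (a \<ominus> c) \<oplus> (b \<ominus> d)"
    if "a \<in> carrier R" "b \<in> carrier R" "c \<in> carrier R" "d \<in> carrier R" for a b c d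
    using that by (simp add: R.minus_eq R.minus_add R.a_ac)
  have mult_minus: "c \<otimes> a \<ominus> c \<otimes> b = c \<otimes> (a \<ominus> b)"
    if "a \<in> carrier R" "b \<in> carrier R" "c \<in> carrier R" for a b c
    using that by (simp add: R.minus_eq R.r_distr R.r_minus)
  show ?thesis
    unfolding bilinear_form_def difference_form_def
    by (auto simp: closed lin smult add_minus mult_minus)
qed

lemma nondegenerate_difference_form:
  fixes R (structure) and M (structure)
  assumes M: "Module.module R M" and B: "bilinear_form R M B" "nondegenerate R M B"
  shows "nondegenerate R (double_module M) (difference_form R B)"
proof -
  interpret module R M by fact
  have closed: "B x y \<in> carrier R" if "x \<in> carrier M" "y \<in> carrier M" for x y
    using B(1) that by (auto simp: bilinear_form_def)
  have neg: "a = \<zero>" if "\<zero> \<ominus> a = \<zero>" "a \<in> carrier R" for a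
    using that R.minus_minus[of a] by (simp add: R.minus_eq)
  note z = bilinear_form_zero[OF M B(1)]
  show ?thesis
    unfolding nondegenerate_def
  proof (intro conjI ballI impI)
    fix p assume "p \<in> carrier (double_module M)"
      and 0: "\<forall>r\<in>carrier (double_module M). difference_form R B p r = \<zero>\<^bsub>R\<^esub>"
    then obtain x x' where p: "p = (x, x')" "x \<in> carrier M" "x' \<in> carrier M" by auto
    have "B x y = \<zero>" if "y \<in> carrier M" for y
      using bspec[OF 0, of "(y, \<zero>\<^bsub>M\<^esub>)"] that p z closed
      by (simp add: difference_form_def R.minus_eq)
    moreover have "B x' y = \<zero>" if "y \<in> carrier M" for y
      using bspec[OF 0, of "(\<zero>\<^bsub>M\<^esub>, y)"] that p z closed neg by (simp add: difference_form_def)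
    ultimately have "x = \<zero>\<^bsub>M\<^esub> \<and> x' = \<zero>\<^bsub>M\<^esub>"
      using B(2) p(2,3) unfolding nondegenerate_def by blast
    then show "p = \<zero>\<^bsub>double_module M\<^esub>" by (simp add: p(1))
  next
    fix p assume "p \<in> carrier (double_module M)"
      and 0: "\<forall>r\<in>carrier (double_module M). difference_form R B r p = \<zero>\<^bsub>R\<^esub>"
    then obtain x x' where p: "p = (x, x')" "x \<in> carrier M" "x' \<in> carrier M" by auto
    have "B y x = \<zero>" if "y \<in> carrier M" for y
      using bspec[OF 0, of "(y, \<zero>\<^bsub>M\<^esub>)"] that p z closed
      by (simp add: difference_form_def R.minus_eq)
    moreover have "B y x' = \<zero>" if "y \<in> carrier M" for y
      using bspec[OF 0, of "(\<zero>\<^bsub>M\<^esub>, y)"] that p z closed neg by (simp add: difference_form_def)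
    ultimately have "x = \<zero>\<^bsub>M\<^esub> \<and> x' = \<zero>\<^bsub>M\<^esub>"
      using B(2) p(2,3) unfolding nondegenerate_def by blast
    then show "p = \<zero>\<^bsub>double_module M\<^esub>" by (simp add: p(1))
  qed
qed

section \<open>Collisions and solvable right-hand sides\<close>

text \<open>
  Cauchy-Schwarz applied to the sizes of the fibres of \<open>f\<close>: few collisions force a large image.
\<close>

lemma card_square_le_image_mult_collisions:
  assumes "finite X"
  shows "(card X)\<^sup>2 \<le> card (f ` X) * card {(x, y). x \<in> X \<and> y \<in> X \<and> f x = f y}"
proof -
  define g where "g k = card {x\<in>X. f x = k}" for k
  have "card X = (\<Sum>k\<in>f ` X. g k)"
    using sum.image_gen[OF assms, of "\<lambda>_. 1::nat" f] by (simp add: g_def)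
  have "{(x, y). x \<in> X \<and> y \<in> X \<and> f x = f y} = (SIGMA x:X. {y\<in>X. f y = f x})" by auto
  then have "card {(x, y). x \<in> X \<and> y \<in> X \<and> f x = f y} = (\<Sum>x\<in>X. g (f x))"
    using assms by (simp add: g_def)
  also have "\<dots> = (\<Sum>k\<in>f ` X. \<Sum>x\<in>{x\<in>X. f x = k}. g (f x))"
    by (rule sum.image_gen[OF assms])
  also have "\<dots> = (\<Sum>k\<in>f ` X. (g k)\<^sup>2)"
    by (intro sum.cong refl) (simp add: g_def power2_eq_square)
  finally have coll: "card {(x, y). x \<in> X \<and> y \<in> X \<and> f x = f y} = (\<Sum>k\<in>f ` X. (g k)\<^sup>2)" .
  have "(\<Sum>k\<in>f ` X. real (g k))\<^sup>2 \<le> (\<Sum>k\<in>f ` X. (real (g k))\<^sup>2) * real (card (f ` X))"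
    by (rule sum_squared_le_sum_of_squares)
  then have "real ((\<Sum>k\<in>f ` X. g k)\<^sup>2) \<le> real ((\<Sum>k\<in>f ` X. (g k)\<^sup>2) * card (f ` X))"
    by simp
  then show ?thesis
    unfolding of_nat_le_iff coll \<open>card X = _\<close> by (simp add: mult.commute)
qed

lemma index_pairs_Suc: "index_pairs (Suc t) = index_pairs t \<union> (\<lambda>i. (i, Suc t)) ` {1..t}"
  unfolding index_pairs_def by auto

lemma finite_index_pairs: "finite (index_pairs t)"
  by (rule finite_subset[of _ "{1..t} \<times> {1..t}"]) (auto simp: index_pairs_def)

lemma card_index_pairs: "card (index_pairs t) = t choose 2"
proof (induction t)
  case 0
  have "index_pairs 0 = {}" by (auto simp: index_pairs_def)
  then show ?case by simp
next
  case (Suc t)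
  have "card (index_pairs (Suc t)) = card (index_pairs t) + card ((\<lambda>i. (i, Suc t)) ` {1..t})"
    unfolding index_pairs_Suc using finite_index_pairs
    by (intro card_Un_disjoint) (auto simp: index_pairs_def)
  also have "card ((\<lambda>i. (i, Suc t)) ` {1..t}) = t" by (simp add: card_image inj_on_def)
  finally show ?case using Suc.IH by (simp add: choose_two_Suc)
qed

lemma finite_solvable_choices:
  assumes "finite (carrier R)"
  shows "finite (solvable_choices R t E B)"
proof (rule finite_subset)
  show "solvable_choices R t E B \<subseteq> index_pairs t \<rightarrow>\<^sub>E carrier R"
    by (auto simp: solvable_choices_def)
qed (use assms finite_index_pairs in \<open>intro finite_PiE\<close>)

lemma card_solvable_choices_le:
  assumes "finite (carrier R)"
  shows "card (solvable_choices R t E B) \<le> card (carrier R) ^ (t choose 2)"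
proof -
  have "card (solvable_choices R t E B) \<le> card (index_pairs t \<rightarrow>\<^sub>E carrier R)"
    using assms finite_index_pairs
    by (intro card_mono finite_PiE) (auto simp: solvable_choices_def)
  then show ?thesis by (simp add: card_PiE finite_index_pairs card_index_pairs)
qed

text \<open>
  The right-hand sides for which the system is solvable are the values of the map that sends a
  tuple of vectors to its table of values of \<open>B\<close>.  Two tuples collide under this map exactly if
  zipping them together gives a clique for orthogonality in the double module, so the number of
  collisions is a clique count.
\<close>

lemma card_power_le_solvable_choices_mult_cliques:
  fixes R (structure) and M (structure)
  assumes M: "Module.module R M" and fin: "finite (carrier R)" "finite (carrier M)"
    and B: "bilinear_form R M B" and E: "E \<subseteq> carrier M"
  shows "card E ^ (2 * t) \<le> card (solvable_choices R t E B) *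
    card (cliques (\<lambda>p r. difference_form R B p r = \<zero>\<^bsub>R\<^esub>) t (E \<times> E))"
proof -
  interpret module R M by fact
  let ?\<Gamma> = "cliques (\<lambda>p r. difference_form R B p r = \<zero>\<^bsub>R\<^esub>) t (E \<times> E)"
  have finE: "finite E" using E fin(2) finite_subset by blast
  have closed: "B x y \<in> carrier R" if "x \<in> E" "y \<in> E" for x y
    using B subsetD[OF E] that by (simp add: bilinear_form_def)
  define X where "X = {xs. set xs \<subseteq> E \<and> length xs = t}"
  \<comment> \<open>The unknowns are numbered from one, the entries of a list from zero.\<close>
  define vals where
    "vals xs = (\<lambda>(i, j)\<in>index_pairs t. B (xs ! (i - 1)) (xs ! (j - 1)))" for xs
  have finX: "finite X" unfolding X_def by (rule finite_lists_length_eq[OF finE])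
  have nth: "xs ! (i - 1) \<in> E" if "xs \<in> X" "1 \<le> i" "i \<le> t" for xs i
  proof -
    have "i - 1 < length xs" using that by (auto simp: X_def)
    then show ?thesis using that nth_mem by (auto simp: X_def)
  qed
  have "vals ` X \<subseteq> solvable_choices R t E B"
  proof
    fix l assume "l \<in> vals ` X"
    then obtain xs where xs: "xs \<in> X" "l = vals xs" by auto
    have "B (xs ! (i - 1)) (xs ! (j - 1)) \<in> carrier R" if "(i, j) \<in> index_pairs t" for i j
      using that by (intro closed nth[OF xs(1)]) (simp_all add: index_pairs_def)
    then have "l \<in> index_pairs t \<rightarrow>\<^sub>E carrier R"
      unfolding xs(2) vals_def restrict_PiE_iff by (simp add: split_beta)
    moreover have "solvable_system t E B l"
      unfolding solvable_system_def xs(2) vals_def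
    proof (intro exI conjI ballI)
      show "xs ! (i - 1) \<in> E" if "i \<in> {1..t}" for i
        using that by (intro nth[OF xs(1)]) simp_all
    qed (simp add: split_beta)
    ultimately show "l \<in> solvable_choices R t E B" by (simp add: solvable_choices_def)
  qed
  then have image: "card (vals ` X) \<le> card (solvable_choices R t E B)"
    using finite_solvable_choices[OF fin(1)] by (intro card_mono)
  let ?P = "{(xs, ys). xs \<in> X \<and> ys \<in> X \<and> vals xs = vals ys}"
  have "inj_on (\<lambda>(xs, ys). zip xs ys) ?P"
  proof (rule inj_on_inverseI[where g = "\<lambda>zs. (map fst zs, map snd zs)"])
    fix p assume "p \<in> ?P"
    then obtain xs ys where "p = (xs, ys)" "length xs = t" "length ys = t" by (auto simp: X_def)
    then show "(\<lambda>zs. (map fst zs, map snd zs)) ((\<lambda>(xs, ys). zip xs ys) p) = p" by simp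
  qed
  moreover have "(\<lambda>(xs, ys). zip xs ys) ` ?P \<subseteq> ?\<Gamma>"
  proof clarify
    fix xs ys assume *: "xs \<in> X" "ys \<in> X" "vals xs = vals ys"
    have "difference_form R B (zip xs ys ! i) (zip xs ys ! j) = \<zero>" if ij: "i < j" "j < t" for i j
    proof -
      have "B (xs ! i) (xs ! j) = B (ys ! i) (ys ! j)"
        using fun_cong[OF *(3), of "(Suc i, Suc j)"] ij by (simp add: vals_def index_pairs_def)
      moreover have "B (ys ! i) (ys ! j) \<in> carrier R"
        using nth[OF *(2), of "Suc i"] nth[OF *(2), of "Suc j"] ij by (intro closed) auto
      ultimately show ?thesis
        using * ij by (simp add: X_def difference_form_def R.minus_eq R.r_neg)
    qed
    moreover have "set (zip xs ys) \<subseteq> E \<times> E"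
      using * by (auto simp: X_def dest: set_zip_leftD set_zip_rightD)
    ultimately show "zip xs ys \<in> ?\<Gamma>"
      using * by (simp add: cliques_def sorted_wrt_iff_nth_less X_def)
  qed
  ultimately have coll: "card ?P \<le> card ?\<Gamma>"
    using finE by (intro card_inj_on_le) (auto intro: finite_cliques)
  have "card E ^ (2 * t) = (card X)\<^sup>2"
    unfolding X_def by (simp add: card_lists_length_eq[OF finE] power_mult[symmetric] mult.commute)
  also have "\<dots> \<le> card (vals ` X) * card ?P"
    by (rule card_square_le_image_mult_collisions[OF finX])
  also have "\<dots> \<le> card (solvable_choices R t E B) * card ?\<Gamma>"
    using image coll by (rule mult_le_mono)
  finally show ?thesis .
qed

text \<open>
  The clique bound is applied to \<open>E \<times> E\<close> in the double module, so \<open>m\<close> is the square of the size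
  of \<open>E\<close>, and \<open>L = \<surd>2 N\<close> where \<open>N\<close> is the size of \<open>M\<close>, because the double module has \<open>N\<^sup>2\<close>
  elements.  With \<open>N = q ^ d\<close> the hypothesis on \<open>E\<close> says that its size is at least a constant
  times \<open>q ^ ((d + t - 1) / 2)\<close>.
\<close>

theorem card_solvable_choices_ge:
  fixes \<eta> :: real and t :: nat
  assumes "t \<ge> 2" and "\<eta> > 0"
  shows "\<exists>C>0. \<forall>(R :: ('a, 'b) ring_scheme) (M :: ('a, 'v, 'c) module_scheme) B E.
    Ring.field R \<longrightarrow> Module.module R M \<longrightarrow> finite (carrier R) \<longrightarrow> finite (carrier M) \<longrightarrow>
    bilinear_form R M B \<longrightarrow> nondegenerate R M B \<longrightarrow> E \<subseteq> carrier M \<longrightarrow>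
    C * real (card (carrier M)) * real (card (carrier R)) ^ (t - 1) \<le> (real (card E))\<^sup>2 \<longrightarrow>
    real (card (carrier R)) ^ (t choose 2) \<le> (1 + \<eta>) * real (card (solvable_choices R t E B))"
proof -
  obtain C where C: "C > 0" and clique_bound:
    "\<forall>(V :: ('v \<times> 'v) set) R q L S m.
      finite V \<longrightarrow> pseudorandom V R q L \<longrightarrow> q \<ge> 1 \<longrightarrow> L > 0 \<longrightarrow> S \<subseteq> V \<longrightarrow>
      real (card S) \<le> m \<longrightarrow> C * L * q ^ (t - 1) \<le> m \<longrightarrow>
      real (card (cliques R t S)) \<le> (1 + \<eta>) * m ^ t / q ^ (t choose 2)"
    using card_cliques_le[OF assms] by (elim exE conjE)
  show ?thesis
  proof (intro exI[of _ "C * sqrt 2"] conjI allI impI)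
    show "C * sqrt 2 > 0" using C by simp
  next
    fix R :: "('a, 'b) ring_scheme" and M :: "('a, 'v, 'c) module_scheme" and B E
    assume F: "Ring.field R" and M: "Module.module R M"
      and fin: "finite (carrier R)" "finite (carrier M)"
      and B: "bilinear_form R M B" "nondegenerate R M B" and E: "E \<subseteq> carrier M"
      and large: "C * sqrt 2 * real (card (carrier M)) * real (card (carrier R)) ^ (t - 1)
        \<le> (real (card E))\<^sup>2"
    let ?R = "\<lambda>p r. difference_form R B p r = \<zero>\<^bsub>R\<^esub>"
    define q where "q = real (card (carrier R))"
    define m where "m = (real (card E))\<^sup>2"
    have "\<zero>\<^bsub>R\<^esub> \<in> carrier R"
      using F by (simp add: field_def domain_def cring_def ring.ring_simprules)
    then have "card (carrier R) > 0" using fin(1) by (auto simp: card_gt_0_iff)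
    then have q: "q \<ge> 1" by (simp add: q_def)
    have "\<zero>\<^bsub>M\<^esub> \<in> carrier M"
      using M by (simp add: Module.module_def abelian_group_def abelian_monoid.zero_closed)
    then have N: "card (carrier M) > 0" using fin(2) by (auto simp: card_gt_0_iff)
    have root: "sqrt (2 * real (card (carrier M \<times> carrier M))) = sqrt 2 * real (card (carrier M))"
      by (simp add: card_cartesian_product real_sqrt_mult)
    have "pseudorandom (carrier M \<times> carrier M) ?R q (sqrt 2 * real (card (carrier M)))"
      using pseudorandom_orthogonality[OF F module_double_module[OF M] fin(1) _
          bilinear_form_difference_form[OF M B(1)] nondegenerate_difference_form[OF M B]] fin(2)
      unfolding root[symmetric] q_def by simp
    moreover have "0 < sqrt 2 * real (card (carrier M))" using N by simp
    moreover have "E \<times> E \<subseteq> carrier M \<times> carrier M" using E by auto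
    moreover have "real (card (E \<times> E)) \<le> m" by (simp add: m_def card_cartesian_product power2_eq_square)
    moreover have "C * (sqrt 2 * real (card (carrier M))) * q ^ (t - 1) \<le> m"
      using large by (simp add: q_def m_def mult_ac)
    ultimately have bound: "real (card (cliques ?R t (E \<times> E))) \<le> (1 + \<eta>) * m ^ t / q ^ (t choose 2)"
      using q fin(2) by (intro clique_bound[rule_format, of "carrier M \<times> carrier M"]) auto
    have "0 < C * sqrt 2 * real (card (carrier M)) * q ^ (t - 1)"
      using C N q by (intro mult_pos_pos) auto
    also have "\<dots> \<le> m" using large by (simp only: q_def m_def)
    finally have m: "m > 0" .
    let ?s = "real (card (solvable_choices R t E B))"
    have "real (card E ^ (2 * t)) \<le> real (card (solvable_choices R t E B) * card (cliques ?R t (E \<times> E)))"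
      using card_power_le_solvable_choices_mult_cliques[OF M fin B(1) E] by (intro of_nat_mono)
    then have "m ^ t \<le> ?s * real (card (cliques ?R t (E \<times> E)))"
      by (simp add: m_def power_mult)
    also have "\<dots> \<le> ?s * ((1 + \<eta>) * m ^ t / q ^ (t choose 2))"
      by (intro mult_left_mono bound) simp
    finally have "m ^ t * q ^ (t choose 2) \<le> m ^ t * ((1 + \<eta>) * ?s)"
      using q by (simp add: pos_le_divide_eq mult_ac)
    then have "q ^ (t choose 2) \<le> (1 + \<eta>) * ?s"
      using m by simp
    then show "real (card (carrier R)) ^ (t choose 2) \<le> (1 + \<eta>) * ?s"
      by (simp add: q_def)
  qed
qed

section \<open>Asymptotics\<close>

theorem theorem2p16:
  fixes d t :: nat
    and q :: "nat \<Rightarrow> nat"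
    and F :: "nat \<Rightarrow> ('a, 'b) ring_scheme"
    and E :: "nat \<Rightarrow> (nat \<Rightarrow> 'a) set"
    and B :: "nat \<Rightarrow> (nat \<Rightarrow> 'a) \<Rightarrow> (nat \<Rightarrow> 'a) \<Rightarrow> 'a"
  assumes "d \<ge> 2" and "t \<ge> 2"
    and "\<And>n. primepow (q n)" and "\<And>n. odd (q n)"
    and "filterlim q at_top sequentially"
    and "\<And>n. Ring.field (F n)" and "\<And>n. card (carrier (F n)) = q n"
    and "\<And>n. E n \<subseteq> carrier (coord_space (F n) d)"
    and "(\<lambda>n. real (q n) powr ((real d + real t - 1) / 2)) \<in> o(\<lambda>n. real (card (E n)))"
    and "\<And>n. bilinear_form (F n) (coord_space (F n) d) (B n)"
    and "\<And>n. nondegenerate (F n) (coord_space (F n) d) (B n)"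
  shows "\<exists>\<epsilon> :: nat \<Rightarrow> real. \<epsilon> \<longlonglongrightarrow> 0 \<and>
    (\<forall>n. real (card (solvable_choices (F n) t (E n) (B n))) =
      (1 - \<epsilon> n) * real (q n) ^ (t choose 2))"
proof -
  have q: "q n > 0" for n using assms(3)[of n] by (simp add: primepow_gt_0_nat)
  have finF: "finite (carrier (F n))" for n
    using q[of n] assms(7)[of n] card_ge_0_finite by metis
  have carrier: "carrier (coord_space (F n) d) = {1..d} \<rightarrow>\<^sub>E carrier (F n)" for n
    by (simp add: coord_space_def)
  have finM: "finite (carrier (coord_space (F n) d))" for n
    unfolding carrier using finF by (intro finite_PiE) auto
  have cardM: "card (carrier (coord_space (F n) d)) = q n ^ d" for n
    unfolding carrier by (simp add: card_PiE assms(7))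
  have mod: "Module.module (F n) (coord_space (F n) d)" for n
    using assms(6)[of n] by (intro coord_space_module) (simp add: field_def domain_def)
  let ?s = "\<lambda>n. real (card (solvable_choices (F n) t (E n) (B n)))"
  let ?Q = "\<lambda>n. real (q n) ^ (t choose 2)"
  have Q: "?Q n > 0" for n using q by simp
  have upper: "?s n \<le> ?Q n" for n
    using of_nat_mono[OF card_solvable_choices_le[OF finF[of n], of t "E n" "B n"], where ?'a = real]
    by (simp add: assms(7))
  define \<epsilon> where "\<epsilon> n = 1 - ?s n / ?Q n" for n
  have nonneg: "\<epsilon> n \<ge> 0" for n using upper[of n] Q[of n] by (simp add: \<epsilon>_def)
  have "\<epsilon> \<longlonglongrightarrow> 0"
  proof (rule LIMSEQ_I)
    fix r :: real assume "r > 0"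
    define \<eta> where "\<eta> = r / 2"
    have \<eta>: "\<eta> > 0" using \<open>r > 0\<close> by (simp add: \<eta>_def)
    obtain C where C: "C > 0" and lower:
      "\<forall>(R :: ('a, 'b) ring_scheme) (M :: ('a, nat \<Rightarrow> 'a) module) B E.
      Ring.field R \<longrightarrow> Module.module R M \<longrightarrow> finite (carrier R) \<longrightarrow> finite (carrier M) \<longrightarrow>
      bilinear_form R M B \<longrightarrow> nondegenerate R M B \<longrightarrow> E \<subseteq> carrier M \<longrightarrow>
      C * real (card (carrier M)) * real (card (carrier R)) ^ (t - 1) \<le> (real (card E))\<^sup>2 \<longrightarrow>
      real (card (carrier R)) ^ (t choose 2) \<le> (1 + \<eta>) * real (card (solvable_choices R t E B))"
      using card_solvable_choices_ge[OF assms(2) \<eta>, where ?'a = 'a and ?'b = 'b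
          and ?'v = "nat \<Rightarrow> 'a" and ?'c = unit] by (elim exE conjE)
    \<comment> \<open>With the factor \<open>1 / sqrt C\<close>, squaring gives the size condition in the bound above.\<close>
    have "\<forall>\<^sub>F n in sequentially. norm (real (q n) powr ((real d + real t - 1) / 2))
        \<le> (1 / sqrt C) * norm (real (card (E n)))"
      using C by (intro landau_o.smallD[OF assms(9)]) simp
    then obtain n0 where n0: "\<And>n. n \<ge> n0 \<Longrightarrow> real (q n) powr ((real d + real t - 1) / 2)
        \<le> (1 / sqrt C) * real (card (E n))"
      unfolding eventually_sequentially by auto
    have "norm (\<epsilon> n - 0) < r" if n: "n \<ge> n0" for n
    proof -
      have "sqrt C * real (q n) powr ((real d + real t - 1) / 2) \<le> real (card (E n))"
        using n0[OF n] C by (simp add: field_simps)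
      then have "(sqrt C * real (q n) powr ((real d + real t - 1) / 2))\<^sup>2 \<le> (real (card (E n)))\<^sup>2"
        using C by (intro power_mono) auto
      moreover have "(real (q n) powr ((real d + real t - 1) / 2))\<^sup>2 = real (q n) ^ d * real (q n) ^ (t - 1)"
      proof -
        have "(real (q n) powr ((real d + real t - 1) / 2))\<^sup>2 = real (q n) powr real (d + (t - 1))"
          using assms(2) by (simp add: power2_eq_square powr_add[symmetric] of_nat_diff)
        also have "\<dots> = real (q n) ^ (d + (t - 1))"
          using q[of n] by (intro powr_realpow) simp
        finally show ?thesis by (simp only: power_add)
      qed
      ultimately have "C * real (q n ^ d) * real (q n) ^ (t - 1) \<le> (real (card (E n)))\<^sup>2"
        using C by (simp add: power_mult_distrib mult.assoc)
      then have "?Q n \<le> (1 + \<eta>) * ?s n"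
        using lower[rule_format, OF assms(6) mod finF finM assms(10,11) assms(8), of n]
        by (simp add: assms(7) cardM)
      then have "1 \<le> (1 + \<eta>) * (?s n / ?Q n)" using Q[of n] by (simp add: field_simps)
      moreover have "\<eta> * (?s n / ?Q n) \<le> \<eta>"
        using upper[of n] Q[of n] \<eta> by (intro mult_left_le) (simp_all only: divide_le_eq_1_pos less_imp_le)
      ultimately have "\<epsilon> n \<le> \<eta>" unfolding \<epsilon>_def distrib_right by linarith
      then show ?thesis using nonneg[of n] \<open>r > 0\<close> by (simp add: \<eta>_def)
    qed
    then show "\<exists>no. \<forall>n\<ge>no. norm (\<epsilon> n - 0) < r" by blast
  qed
  moreover have "?s n = (1 - \<epsilon> n) * ?Q n" for n
    using Q[of n] q[of n] by (simp add: \<epsilon>_def)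
  ultimately show ?thesis by blast
qed

end
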